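(* Let $X,Y$ be Hilbert spaces and let $A:X\to Y$ be an injective compact linear operator with $\|A\|=1$, $\dim \mathcal{R}(A)=\infty$, and singular system $\{\sigma_i,u_i,v_i\}_{i=1}^\infty$. Let $x^\dagger\in X$, $y=Ax^\dagger$, and for $\alpha>0$ let $x_\alpha=(A^*A+\alpha I)^{-1}A^*y$. Let $\mu>0$ and $\nu\in\mathbb{R}$ satisfy $0<\mu+\nu<1$. Then $$\|(A^*A)^\nu(x_\alpha-x^\dagger)\|^2=\mathcal{O}\left(\alpha^{2(\nu+\mu)}\right)\qquad\text{as }\alpha\to 0^+$$ if and only if $$\sum_{n=k}^\infty\langle x^\dagger,v_n\rangle^2=\mathcal{O}(\sigma_k^{4\mu})\qquad\text{as }k\to\infty.$$
   Context: Singular system: $\sigma_1\ge\sigma_2\ge\dots>0$ with $\sigma_i\to 0$, $\{u_i\}$ is an orthonormal basis of $\overline{\mathcal{R}(A)}$, $\{v_i\}$ is an orthonormal basis of $\overline{\mathcal{R}(A^* )}$, and $Av_i=\sigma_iu_i$, $A^*u_i=\sigma_iv_i$ for all $i\in\mathbb{N}$. Every $x\in X$ is assumed to have the expansion $x=\sum_{i=1}^\infty\langle x,v_i\rangle v_i$ (equivalently, $A$ is injective). If the spaces are complex, $\langle\cdot,\cdot\rangle^2$ is read as $|\langle\cdot,\cdot\rangle|^2$. Here $x_\alpha$ is the Tikhonov approximation with exact data, i.e. the unique minimizer over $x\in X$ of $\frac12\|Ax-y\|^2+\frac{\alpha}{2}\|x\|^2$. Powers of $A^*A$ are defined spectrally: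 $(A^*A)^\nu x=\sum_{i=1}^\infty\sigma_i^{2\nu}\langle x,v_i\rangle v_i$, and $\|(A^*A)^\nu x\|^2=\sum_{i=1}^\infty\sigma_i^{4\nu}\langle x,v_i\rangle^2\in[0,\infty]$ (the value $+\infty$, meaning that $x$ is not in the domain, can only occur for $\nu<0$). $f(\alpha)=\mathcal{O}(g(\alpha))$ as $\alpha\to0^+$ means there are $C,\alpha_0>0$ with $f(\alpha)\le C g(\alpha)$ for all $0<\alpha\le\alpha_0$; $a_k=\mathcal{O}(b_k)$ as $k\to\infty$ means there are $C,k_0$ with $a_k\le Cb_k$ for all $k\ge k_0$. *)

theory Defs
  imports "HOL-Analysis.Analysis" "HOL-Library.Landau_Symbols"
begin

text \<open>
  The library's \<^class>\<open>real_inner\<close> covers real Hilbert spaces only, and there is no class of complex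
  inner product spaces. To treat both cases at once, the scalars are an abstract normed field with a
  conjugation, and scalar multiplication and inner product of a Hilbert space are explicit
  parameters. Norm, topology and completeness are those of the class \<^class>\<open>banach\<close>.

  Since the norm of a \<^class>\<open>real_normed_field\<close> is multiplicative, the reals and the complex numbers
  are, by the theorem of Gelfand and Mazur, the only models of the following class.
\<close>

class conj_field = real_normed_field +
  fixes conjugate :: "'a \<Rightarrow> 'a"
  assumes conjugate_add: "conjugate (a + b) = conjugate a + conjugate b"
    and conjugate_mult: "conjugate (a * b) = conjugate a * conjugate b"
    and mult_conjugate: "a * conjugate a = (norm a)\<^sup>2 *\<^sub>R 1"

instantiation real :: conj_field
begin

definition conjugate_real :: "real \<Rightarrow> real" where "conjugate_real a = a"

instance
  by standard (simp_all add: conjugate_real_def power2_eq_square)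

end

instantiation complex :: conj_field
begin

definition conjugate_complex :: "complex \<Rightarrow> complex" where "conjugate_complex = cnj"

instance
  by standard (simp_all add: conjugate_complex_def complex_norm_square scaleR_conv_of_real
      del: of_real_power)

end

locale hilbert_space = vector_space smul
  for smul :: "'k::conj_field \<Rightarrow> 'a::banach \<Rightarrow> 'a" (infixr \<open>\<odot>\<close> 75) +
  fixes ip :: "'a \<Rightarrow> 'a \<Rightarrow> 'k"
  assumes smul_of_real: "of_real r \<odot> x = r *\<^sub>R x"
    and ip_add_left: "ip (x + y) z = ip x z + ip y z"
    and ip_smul_left: "ip (a \<odot> x) y = a * ip x y"
    and ip_commute: "ip x y = conjugate (ip y x)"
    and ip_self: "ip x x = of_real ((norm x)\<^sup>2)"

lemma hilbert_space_real_inner: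
  "hilbert_space (scaleR :: real \<Rightarrow> 'a \<Rightarrow> 'a::{real_inner, banach}) inner"
  by unfold_locales
    (simp_all add: algebra_simps inner_add_left inner_commute conjugate_real_def power2_norm_eq_inner)

lemma hilbert_space_complex: "hilbert_space (*) (\<lambda>x y :: complex. x * cnj y)"
  by unfold_locales
    (simp_all add: algebra_simps conjugate_complex_def complex_norm_square scaleR_conv_of_real
      del: of_real_power)

text \<open>
  By the Riesz representation theorem the adjoint of a bounded linear operator exists; it is unique.
\<close>

definition hilbert_adjoint ::
  "('a \<Rightarrow> 'a \<Rightarrow> 'k) \<Rightarrow> ('b \<Rightarrow> 'b \<Rightarrow> 'k) \<Rightarrow> ('a \<Rightarrow> 'b) \<Rightarrow> 'b \<Rightarrow> 'a" where
  "hilbert_adjoint ipX ipY A = (THE B. \<forall>x y. ipY (A x) y = ipX x (B y))"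

definition compact_operator :: "('a::real_normed_vector \<Rightarrow> 'b::real_normed_vector) \<Rightarrow> bool" where
  "compact_operator A \<longleftrightarrow> (\<forall>S. bounded S \<longrightarrow> compact (closure (A ` S)))"

definition orthonormal :: "('a \<Rightarrow> 'a \<Rightarrow> 'k::conj_field) \<Rightarrow> (nat \<Rightarrow> 'a) \<Rightarrow> bool" where
  "orthonormal ip e \<longleftrightarrow> (\<forall>i j. ip (e i) (e j) = (if i = j then 1 else 0))"

definition orthonormal_basis ::
  "('k::conj_field \<Rightarrow> 'a::banach \<Rightarrow> 'a) \<Rightarrow> ('a \<Rightarrow> 'a \<Rightarrow> 'k) \<Rightarrow> (nat \<Rightarrow> 'a) \<Rightarrow> 'a set \<Rightarrow> bool" where
  "orthonormal_basis smul ip e M \<longleftrightarrow>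
     orthonormal ip e \<and> closure (module.span smul (range e)) = M"

text \<open>Singular systems are indexed from 0.\<close>

definition singular_system ::
  "('k::conj_field \<Rightarrow> 'a::banach \<Rightarrow> 'a) \<Rightarrow> ('a \<Rightarrow> 'a \<Rightarrow> 'k) \<Rightarrow>
   ('k \<Rightarrow> 'b::banach \<Rightarrow> 'b) \<Rightarrow> ('b \<Rightarrow> 'b \<Rightarrow> 'k) \<Rightarrow>
   ('a \<Rightarrow> 'b) \<Rightarrow> (nat \<Rightarrow> real) \<Rightarrow> (nat \<Rightarrow> 'b) \<Rightarrow> (nat \<Rightarrow> 'a) \<Rightarrow> bool" where
  "singular_system smulX ipX smulY ipY A \<sigma> u v \<longleftrightarrow>
     antimono \<sigma> \<and> (\<forall>i. 0 < \<sigma> i) \<and> \<sigma> \<longlonglongrightarrow> 0 \<and>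
     orthonormal_basis smulY ipY u (closure (range A)) \<and>
     orthonormal_basis smulX ipX v (closure (range (hilbert_adjoint ipX ipY A))) \<and>
     (\<forall>i. A (v i) = \<sigma> i *\<^sub>R u i) \<and>
     (\<forall>i. hilbert_adjoint ipX ipY A (u i) = \<sigma> i *\<^sub>R v i)"

definition tikhonov ::
  "('a::banach \<Rightarrow> 'a \<Rightarrow> 'k) \<Rightarrow> ('b::banach \<Rightarrow> 'b \<Rightarrow> 'k) \<Rightarrow> ('a \<Rightarrow> 'b) \<Rightarrow> 'b \<Rightarrow> real \<Rightarrow> 'a" where
  "tikhonov ipX ipY A y \<alpha> =
     inv (\<lambda>x. hilbert_adjoint ipX ipY A (A x) + \<alpha> *\<^sub>R x) (hilbert_adjoint ipX ipY A y)"

text \<open>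
  The term of index \<open>i\<close> in the series defining the vector \<open>(A\<^sup>*A)\<^sup>\<nu> x\<close>, where \<open>\<sigma>\<close> and \<open>v\<close> are part of
  a singular system of the operator \<open>A\<close>. The vector \<open>x\<close> lies in the domain iff the series converges.
\<close>

definition spectral_term ::
  "('k::conj_field \<Rightarrow> 'a::banach \<Rightarrow> 'a) \<Rightarrow> ('a \<Rightarrow> 'a \<Rightarrow> 'k) \<Rightarrow> (nat \<Rightarrow> real) \<Rightarrow> (nat \<Rightarrow> 'a) \<Rightarrow>
   real \<Rightarrow> 'a \<Rightarrow> nat \<Rightarrow> 'a" where
  "spectral_term smul ip \<sigma> v \<nu> x i = smul (of_real (\<sigma> i powr (2 * \<nu>)) * ip x (v i)) (v i)"

definition spectral_power ::
  "('k::conj_field \<Rightarrow> 'a::banach \<Rightarrow> 'a) \<Rightarrow> ('a \<Rightarrow> 'a \<Rightarrow> 'k) \<Rightarrow> (nat \<Rightarrow> real) \<Rightarrow> (nat \<Rightarrow> 'a) \<Rightarrow>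
   real \<Rightarrow> 'a \<Rightarrow> 'a" where
  "spectral_power smul ip \<sigma> v \<nu> x = (\<Sum>i. spectral_term smul ip \<sigma> v \<nu> x i)"

definition spectral_power_norm_sq ::
  "('k::conj_field \<Rightarrow> 'a::banach \<Rightarrow> 'a) \<Rightarrow> ('a \<Rightarrow> 'a \<Rightarrow> 'k) \<Rightarrow> (nat \<Rightarrow> real) \<Rightarrow> (nat \<Rightarrow> 'a) \<Rightarrow>
   real \<Rightarrow> 'a \<Rightarrow> ennreal" where
  "spectral_power_norm_sq smul ip \<sigma> v \<nu> x =
     (if summable (spectral_term smul ip \<sigma> v \<nu> x)
      then ennreal ((norm (spectral_power smul ip \<sigma> v \<nu> x))\<^sup>2) else \<infinity>)"

context hilbert_space
begin

lemma norm_smul: "norm (a \<odot> x) = norm a * norm x"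
proof -
  have "(of_real ((norm (a \<odot> x))\<^sup>2) :: 'k) = ip (a \<odot> x) (a \<odot> x)"
    by (simp only: ip_self)
  also have "\<dots> = a * conjugate (a * ip x x)"
    by (metis ip_commute ip_smul_left)
  also have "\<dots> = (a * conjugate a) * ip x x"
    by (simp add: conjugate_mult mult.assoc flip: ip_commute)
  also have "\<dots> = of_real ((norm a * norm x)\<^sup>2)"
    by (simp only: mult_conjugate ip_self power_mult_distrib of_real_mult of_real_def[of "(norm a)\<^sup>2"])
  finally have "(norm (a \<odot> x))\<^sup>2 = (norm a * norm x)\<^sup>2"
    using of_real_eq_iff by blast
  thus ?thesis
    by (simp add: power2_eq_iff_nonneg)
qed

lemma pythagoras:
  assumes "ip x y = 0"
  shows "(norm (x + y))\<^sup>2 = (norm x)\<^sup>2 + (norm y)\<^sup>2"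
proof -
  have yx: "ip y x = 0"
    using assms ip_commute[of y x] by (metis conjugate_add add_cancel_right_right)
  have "ip (x + y) (x + y) = conjugate (ip x (x + y)) + conjugate (ip y (x + y))"
    by (metis ip_add_left ip_commute conjugate_add)
  also have "\<dots> = ip (x + y) x + ip (x + y) y"
    by (simp flip: ip_commute)
  also have "\<dots> = ip x x + ip y y"
    by (simp add: ip_add_left assms yx)
  finally have "(of_real ((norm (x + y))\<^sup>2) :: 'k) = of_real ((norm x)\<^sup>2 + (norm y)\<^sup>2)"
    by (simp only: ip_self of_real_add)
  thus ?thesis
    using of_real_eq_iff by blast
qed

lemma ip_zero_left: "ip 0 y = 0"
  using ip_add_left[of 0 0 y] by simp

lemma ip_sum_left: "ip (\<Sum>i\<in>F. f i) y = (\<Sum>i\<in>F. ip (f i) y)"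
  by (induction F rule: infinite_finite_induct) (simp_all add: ip_zero_left ip_add_left)

lemma conjugate_0: "conjugate (0::'k) = 0"
  using conjugate_add[of "0::'k" 0] by simp

lemma norm_sum_orthonormal:
  assumes "orthonormal ip e" "finite F"
  shows "(norm (\<Sum>i\<in>F. a i \<odot> e i))\<^sup>2 = (\<Sum>i\<in>F. (norm (a i))\<^sup>2)"
  using assms(2)
proof induction
  case (insert j F)
  have n: "norm (e j) = 1"
  proof -
    have "(of_real ((norm (e j))\<^sup>2) :: 'k) = of_real 1"
      using assms(1) ip_self[of "e j"] by (simp add: orthonormal_def)
    hence "(norm (e j))\<^sup>2 = 1"
      using of_real_eq_iff by blast
    thus ?thesis by (simp add: power2_eq_1_iff) (metis norm_ge_zero not_one_le_zero neg_0_le_iff_le)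
  qed
  have "ip (\<Sum>i\<in>F. a i \<odot> e i) (e j) = 0"
    using assms(1) insert.hyps
    by (auto simp: ip_sum_left ip_smul_left orthonormal_def intro!: sum.neutral)
  hence "ip (a j \<odot> e j) (\<Sum>i\<in>F. a i \<odot> e i) = 0"
    by (subst ip_smul_left, subst ip_commute) (simp add: conjugate_0)
  from pythagoras[OF this] show ?case
    using insert by (simp add: norm_smul n)
qed simp

lemma summable_orthonormal_iff:
  assumes "orthonormal ip e"
  shows "summable (\<lambda>i. a i \<odot> e i) \<longleftrightarrow> summable (\<lambda>i. (norm (a i))\<^sup>2)"
proof -
  have "(norm (\<Sum>i\<in>{m..<n}. a i \<odot> e i))\<^sup>2 = norm (\<Sum>i\<in>{m..<n}. (norm (a i))\<^sup>2)" for m n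
    by (simp add: norm_sum_orthonormal[OF assms] sum_nonneg)
  hence *: "norm (\<Sum>i\<in>{m..<n}. a i \<odot> e i) < r \<longleftrightarrow> norm (\<Sum>i\<in>{m..<n}. (norm (a i))\<^sup>2) < r\<^sup>2"
    if "r > 0" for m n r
    using that by (metis power_strict_mono power_less_imp_less_base norm_ge_zero
        less_imp_le zero_less_numeral)
  show ?thesis
  proof
    assume L: "summable (\<lambda>i. a i \<odot> e i)"
    show "summable (\<lambda>i. (norm (a i))\<^sup>2)"
      unfolding summable_Cauchy
    proof safe
      fix r :: real assume "r > 0"
      with L obtain N where "\<forall>m\<ge>N. \<forall>n. norm (\<Sum>i\<in>{m..<n}. a i \<odot> e i) < sqrt r"
        unfolding summable_Cauchy by (meson real_sqrt_gt_zero)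
      with *[of "sqrt r"] \<open>r > 0\<close>
      show "\<exists>N. \<forall>m\<ge>N. \<forall>n. norm (\<Sum>i\<in>{m..<n}. (norm (a i))\<^sup>2) < r"
        by (metis real_sqrt_gt_zero real_sqrt_pow2 less_imp_le)
    qed
  next
    assume R: "summable (\<lambda>i. (norm (a i))\<^sup>2)"
    show "summable (\<lambda>i. a i \<odot> e i)"
      unfolding summable_Cauchy
    proof safe
      fix r :: real assume "r > 0"
      with R obtain N where "\<forall>m\<ge>N. \<forall>n. norm (\<Sum>i\<in>{m..<n}. (norm (a i))\<^sup>2) < r\<^sup>2"
        unfolding summable_Cauchy by (meson zero_less_power)
      with *[of r] \<open>r > 0\<close>
      show "\<exists>N. \<forall>m\<ge>N. \<forall>n. norm (\<Sum>i\<in>{m..<n}. a i \<odot> e i) < r"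
        by blast
    qed
  qed
qed

lemma parseval:
  assumes "orthonormal ip e" "summable (\<lambda>i. a i \<odot> e i)"
  shows "(norm (\<Sum>i. a i \<odot> e i))\<^sup>2 = (\<Sum>i. (norm (a i))\<^sup>2)"
proof -
  have "(\<lambda>n. (norm (\<Sum>i<n. a i \<odot> e i))\<^sup>2) \<longlonglongrightarrow> (norm (\<Sum>i. a i \<odot> e i))\<^sup>2"
    by (intro tendsto_intros summable_LIMSEQ assms)
  moreover have "(\<lambda>n. \<Sum>i<n. (norm (a i))\<^sup>2) \<longlonglongrightarrow> (\<Sum>i. (norm (a i))\<^sup>2)"
    using assms by (intro summable_LIMSEQ) (simp add: summable_orthonormal_iff)
  ultimately show ?thesis
    by (simp add: norm_sum_orthonormal[OF assms(1)] LIMSEQ_unique)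
qed

lemma spectral_power_norm_sq_eq:
  assumes "orthonormal ip v"
  shows "spectral_power_norm_sq smul ip \<sigma> v \<nu> x =
    (\<Sum>i. ennreal (\<sigma> i powr (4 * \<nu>) * (norm (ip x (v i)))\<^sup>2))"
proof -
  define a where "a i = of_real (\<sigma> i powr (2 * \<nu>)) * ip x (v i)" for i
  have a: "(norm (a i))\<^sup>2 = \<sigma> i powr (4 * \<nu>) * (norm (ip x (v i)))\<^sup>2" for i
    by (simp add: a_def norm_mult power_mult_distrib power2_eq_square flip: powr_add)
  have t: "spectral_term smul ip \<sigma> v \<nu> x = (\<lambda>i. a i \<odot> v i)"
    by (simp add: spectral_term_def a_def fun_eq_iff)
  show ?thesis
  proof (cases "summable (\<lambda>i. a i \<odot> v i)")
    case True
    hence "summable (\<lambda>i. (norm (a i))\<^sup>2)"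
      by (simp add: summable_orthonormal_iff[OF assms])
    with True show ?thesis
      by (simp add: spectral_power_norm_sq_def spectral_power_def t parseval[OF assms]
          suminf_ennreal2 flip: a)
  next
    case False
    hence "\<not> summable (\<lambda>i. (norm (a i))\<^sup>2)"
      by (simp add: summable_orthonormal_iff[OF assms])
    hence "(\<Sum>i. ennreal ((norm (a i))\<^sup>2)) = top"
      using summable_suminf_not_top[of "\<lambda>i. (norm (a i))\<^sup>2", OF zero_le_power2] by blast
    with False show ?thesis
      by (simp add: spectral_power_norm_sq_def t flip: a)
  qed
qed

end

end

theory Submission
  imports Defs
begin

text \<open>
  Write \<open>s\<^sub>n = \<sigma>\<^sub>n\<^sup>2\<close> and \<open>c\<^sub>n = |\<langle>x, v\<^sub>n\<rangle>|\<^sup>2\<close>. Testing the normal equation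
  \<open>A\<^sup>*A x\<^sub>\<alpha> + \<alpha> x\<^sub>\<alpha> = A\<^sup>*A x\<close> against \<open>v\<^sub>n\<close> shows that \<open>x\<^sub>\<alpha> - x\<close> has the coefficients
  \<open>- \<alpha> / (s\<^sub>n + \<alpha>) \<langle>x, v\<^sub>n\<rangle>\<close> (\<open>tikhonov_coefficient\<close>), so the squared error in question is
  \<open>F(\<alpha>) = \<Sum>\<^sub>n s\<^sub>n\<^bsup>2\<nu>\<^esup> (\<alpha> / (s\<^sub>n + \<alpha>))\<^sup>2 c\<^sub>n\<close>, and the theorem is a statement about two sequences of
  nonnegative numbers.

  On the other side, because \<open>s\<close> decreases to 0, the tail condition says that the mass
  \<open>M(t) = \<Sum>\<^bsub>s\<^sub>n \<le> t\<^esub> c\<^sub>n\<close> is \<open>O(t\<^bsup>2\<mu>\<^esup>)\<close> as \<open>t \<rightarrow> 0\<close> (\<open>tails_bigo_iff_mass_below\<close>). In this form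
  the index \<open>n\<close> no longer matters and \<open>s\<^sub>n\<close> can be compared with \<open>\<alpha>\<close> directly: the filter factor
  \<open>(\<alpha> / (s\<^sub>n + \<alpha>))\<^sup>2\<close> lies between \<open>1/4\<close> and \<open>1\<close> where \<open>s\<^sub>n \<le> \<alpha>\<close>, and is at most \<open>(\<alpha> / s\<^sub>n)\<^sup>2\<close>
  elsewhere.

  What remains is to insert or remove powers of \<open>s\<^sub>n\<close> as weights. On a dyadic shell, where \<open>s\<^sub>n\<close> is
  comparable to \<open>\<tau>\<close>, the weight \<open>s\<^sub>n\<^sup>q\<close> is comparable to \<open>\<tau>\<^sup>q\<close>, so a bound \<open>O(\<tau>\<^sup>p)\<close> for the masses
  gives \<open>O(\<tau>\<^bsup>p+q\<^esup>)\<close> for the weighted mass of the shell, and the bounds for the shells form a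
  geometric series (\<open>geometric_shells_sum\<close>). It converges towards 0 if \<open>p + q > 0\<close> and towards
  infinity if \<open>p + q < 0\<close>. If \<open>F(\<alpha>) = O(\<alpha>\<^bsup>2(\<nu>+\<mu>)\<^esup>)\<close>, removing the weight
  \<open>s\<^sub>n\<^bsup>2\<nu>\<^esup>\<close> below \<open>\<alpha>\<close> leaves the exponent \<open>2\<mu> > 0\<close>. Conversely, the part of \<open>F(\<alpha>)\<close> with \<open>s\<^sub>n \<le> \<alpha>\<close>
  has the exponent \<open>2(\<mu> + \<nu>) > 0\<close> and the part with \<open>s\<^sub>n > \<alpha>\<close> the exponent \<open>2(\<mu> + \<nu> - 1) < 0\<close>. Thus
  each of the three inequalities for \<open>\<mu>\<close> and \<open>\<nu>\<close> is the convergence of one geometric series.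

  The formula for the coefficients needs the adjoint of \<open>A\<close>, which is obtained from the Riesz representation
  theorem (\<open>riesz_representation\<close>), and the completeness of the system \<open>v\<close>, which follows from the
  injectivity of \<open>A\<close>.
\<close>

section \<open>Inner products over a normed field with conjugation\<close>

context hilbert_space
begin

lemma conjugate_of_real: "conjugate (of_real r :: 'k) = of_real r"
proof (cases "r = 0")
  case False
  have "of_real r * conjugate (of_real r :: 'k) = of_real r * of_real r"
    using mult_conjugate[of "of_real r :: 'k"]
    by (simp add: of_real_def power2_eq_square)
  with False show ?thesis
    by simp
qed (simp add: conjugate_0)

lemma ip_scaleR_left: "ip (r *\<^sub>R x) y = r *\<^sub>R ip x y"
  by (simp add: ip_smul_left scaleR_conv_of_real flip: smul_of_real)

lemma ip_scaleR_right: "ip x (r *\<^sub>R y) = r *\<^sub>R ip x y"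
  using ip_commute[of x y] ip_commute[of x "r *\<^sub>R y"]
  by (simp add: ip_scaleR_left conjugate_mult conjugate_of_real scaleR_conv_of_real)

lemma ip_diff_left: "ip (x - y) z = ip x z - ip y z"
  using ip_add_left[of "x - y" y z] by (simp add: algebra_simps)

lemma ip_eq_0_commute: "ip x y = 0 \<longleftrightarrow> ip y x = 0"
  by (metis ip_commute conjugate_0)

lemma ip_add_right: "ip x (y + z) = ip x y + ip x z"
  using ip_commute[of x "y + z"] ip_commute[of x y] ip_commute[of x z]
  by (simp add: ip_add_left conjugate_add)

lemma ip_diff_right: "ip x (y - z) = ip x y - ip x z"
  using ip_add_right[of x "y - z" z] by (simp add: algebra_simps)

lemma ip_self_eq_0_iff: "ip x x = 0 \<longleftrightarrow> x = 0"
  unfolding ip_self by simp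

text \<open>
  The component of \<open>x\<close> along \<open>w\<close> splits off orthogonally. Both the Cauchy-Schwarz inequality and the
  orthogonality of a shortest vector in the Riesz theorem are read off from this identity.
\<close>

lemma pythagoras_projection:
  fixes x w :: 'a
  assumes "w \<noteq> 0"
  defines "a \<equiv> ip x w / of_real ((norm w)\<^sup>2)"
  shows "(norm x)\<^sup>2 = (norm (x - a \<odot> w))\<^sup>2 + (norm (ip x w) / norm w)\<^sup>2"
proof -
  have "a * ip w w = ip x w"
    using assms by (simp add: ip_self)
  hence "ip (x - a \<odot> w) w = 0"
    by (simp add: ip_diff_left ip_smul_left)
  hence "ip (a \<odot> w) (x - a \<odot> w) = 0"
    by (metis ip_smul_left ip_eq_0_commute mult_zero_right)
  moreover have "norm (a \<odot> w) = norm (ip x w) / norm w"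
    using assms by (simp add: norm_smul norm_divide norm_power power2_eq_square norm_mult)
  ultimately show ?thesis
    using pythagoras[of "a \<odot> w" "x - a \<odot> w"] by simp
qed

lemma cauchy_schwarz: "norm (ip x y) \<le> norm x * norm y"
proof (cases "y = 0")
  case True
  then show ?thesis
    using ip_eq_0_commute ip_zero_left by force
next
  case False
  have "(norm (ip x y) / norm y)\<^sup>2 \<le> (norm x)\<^sup>2"
    using pythagoras_projection[OF False, of x] by simp
  hence "norm (ip x y) / norm y \<le> norm x"
    by (rule power2_le_imp_le) simp
  with False show ?thesis
    by (simp add: divide_simps)
qed

lemma bounded_linear_ip: "bounded_linear (\<lambda>x. ip x y)"
  by (rule bounded_linear_intro[where K = "norm y"])
    (simp_all add: ip_add_left ip_scaleR_left cauchy_schwarz)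

lemma parallelogram:
  fixes x y :: 'a
  shows "(norm (x + y))\<^sup>2 + (norm (x - y))\<^sup>2 = 2 * (norm x)\<^sup>2 + 2 * (norm y)\<^sup>2"
proof -
  have "(of_real ((norm (x + y))\<^sup>2 + (norm (x - y))\<^sup>2) :: 'k)
      = of_real (2 * (norm x)\<^sup>2 + 2 * (norm y)\<^sup>2)"
    unfolding of_real_add of_real_mult ip_self[symmetric]
    by (simp add: ip_add_left ip_add_right ip_diff_left ip_diff_right)
  thus ?thesis
    using of_real_eq_iff by blast
qed

text \<open>
  By the parallelogram law a norm-minimizing sequence is Cauchy as soon as the midpoints stay in the
  set.
\<close>

lemma closest_to_origin:
  fixes S :: "'a set"
  assumes "closed S" "S \<noteq> {}" and mid: "\<And>x y. x \<in> S \<Longrightarrow> y \<in> S \<Longrightarrow> (1/2) *\<^sub>R (x + y) \<in> S"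
  obtains z where "z \<in> S" "\<And>x. x \<in> S \<Longrightarrow> norm z \<le> norm x"
proof -
  define d where "d = Inf (norm ` S)"
  have d: "d \<le> norm x" if "x \<in> S" for x
    unfolding d_def using that by (intro cInf_lower) (auto intro!: bdd_belowI[of _ 0])
  have d0: "0 \<le> d"
    unfolding d_def using assms by (intro cInf_greatest) auto
  have "\<exists>x\<in>S. norm x < d + 1 / Suc n" for n
    using cInf_lessD[of "norm ` S" "d + 1 / Suc n"] assms(2) by (auto simp: d_def)
  then obtain X where X: "X n \<in> S" "norm (X n) < d + 1 / Suc n" for n
    by metis
  have norm_lim: "(\<lambda>n. norm (X n)) \<longlonglongrightarrow> d"
  proof (rule real_tendsto_sandwich[of "\<lambda>_. d" _ _ "\<lambda>n. d + 1 / Suc n"])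
    show "(\<lambda>n. d + 1 / Suc n) \<longlonglongrightarrow> d"
      using tendsto_add[OF tendsto_const LIMSEQ_inverse_real_of_nat, of d]
      by (simp add: inverse_eq_divide)
  qed (use X d in \<open>auto intro!: always_eventually less_imp_le\<close>)
  have "(\<lambda>n. 2 * ((norm (X n))\<^sup>2 - d\<^sup>2)) \<longlonglongrightarrow> 2 * (d\<^sup>2 - d\<^sup>2)"
    by (intro tendsto_intros norm_lim)
  hence lim: "(\<lambda>n. 2 * ((norm (X n))\<^sup>2 - d\<^sup>2)) \<longlonglongrightarrow> 0"
    by simp
  have close: "(norm (X m - X n))\<^sup>2 \<le> 2 * ((norm (X m))\<^sup>2 - d\<^sup>2) + 2 * ((norm (X n))\<^sup>2 - d\<^sup>2)" for m n
  proof -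
    have "d \<le> norm ((1/2) *\<^sub>R (X m + X n))"
      using d mid X by blast
    hence "(2 * d)\<^sup>2 \<le> (norm (X m + X n))\<^sup>2"
      using d0 by (intro power_mono) auto
    with parallelogram[of "X m" "X n"] show ?thesis
      by (simp add: power2_eq_square)
  qed
  have "Cauchy X"
  proof (rule CauchyI)
    fix e :: real assume "0 < e"
    hence "eventually (\<lambda>n. 2 * ((norm (X n))\<^sup>2 - d\<^sup>2) < e\<^sup>2 / 2) sequentially"
      by (intro order_tendstoD(2)[OF lim]) auto
    then obtain N where N: "\<And>n. n \<ge> N \<Longrightarrow> 2 * ((norm (X n))\<^sup>2 - d\<^sup>2) < e\<^sup>2 / 2"
      by (auto simp: eventually_sequentially)
    have "norm (X m - X n) < e" if "m \<ge> N" "n \<ge> N" for m n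
      using N[OF that(1)] N[OF that(2)] close[of m n] \<open>0 < e\<close>
      by (intro power2_less_imp_less[of _ e]) auto
    thus "\<exists>N. \<forall>m\<ge>N. \<forall>n\<ge>N. norm (X m - X n) < e"
      by blast
  qed
  then obtain z where z: "X \<longlonglongrightarrow> z"
    using Cauchy_convergent_iff convergent_def by blast
  show thesis
  proof
    show "z \<in> S"
      using assms(1) X(1) z closed_sequentially by blast
    have "norm z = d"
      using tendsto_norm[OF z] norm_lim LIMSEQ_unique by blast
    thus "norm z \<le> norm x" if "x \<in> S" for x
      using d that by simp
  qed
qed

text \<open>
  A shortest vector \<open>z\<close> with \<open>f z = 1\<close> is orthogonal to the kernel of \<open>f\<close>: removing from \<open>z\<close> its component
  along a vector of the kernel does not change \<open>f z\<close>, so it cannot make \<open>z\<close> shorter. Since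
  \<open>x - f x \<odot> z\<close> is in the kernel for every \<open>x\<close>, a multiple of \<open>z\<close> represents \<open>f\<close>.
\<close>

lemma riesz_representation:
  assumes "bounded_linear f" and smul: "\<And>a x. f (a \<odot> x) = a * f x"
  obtains b where "\<And>x. f x = ip x b"
proof (cases "\<exists>x. f x \<noteq> 0")
  case False
  show thesis
  proof
    show "f x = ip x 0" for x
      using False ip_eq_0_commute ip_zero_left by metis
  qed
next
  case True
  interpret f: bounded_linear f by fact
  define S where "S = {x. f x = 1}"
  from True obtain x\<^sub>0 where "f x\<^sub>0 \<noteq> 0" by blast
  hence "(1 / f x\<^sub>0) \<odot> x\<^sub>0 \<in> S"
    by (simp add: S_def smul)
  moreover have "closed S"
    unfolding S_def by (intro closed_Collect_eq continuous_intros f.continuous_on)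
  moreover have "(1/2) *\<^sub>R (x + y) \<in> S" if "x \<in> S" "y \<in> S" for x y
    using that by (simp add: S_def f.add f.scaleR scaleR_conv_of_real)
  ultimately obtain z where z: "z \<in> S" "\<And>x. x \<in> S \<Longrightarrow> norm z \<le> norm x"
    using closest_to_origin[of S] by blast
  have orth: "ip w z = 0" if "f w = 0" for w
  proof (cases "w = 0")
    case False
    define a where "a = ip z w / of_real ((norm w)\<^sup>2)"
    have "norm z \<le> norm (z - a \<odot> w)"
      using z(1) that by (intro z(2)) (simp add: S_def f.diff smul)
    hence "(norm z)\<^sup>2 \<le> (norm (z - a \<odot> w))\<^sup>2"
      by (simp add: power_mono)
    with pythagoras_projection[OF False, of z] have "(norm (ip z w) / norm w)\<^sup>2 \<le> 0"
      unfolding a_def by linarith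
    hence "ip z w = 0"
      using False by simp
    thus ?thesis
      by (simp add: ip_eq_0_commute)
  qed (simp add: ip_zero_left)
  have z0: "z \<noteq> 0"
    using z(1) f.zero by (auto simp: S_def)
  show thesis
  proof
    fix x
    have "ip (x - f x \<odot> z) z = 0"
      using z(1) by (intro orth) (simp add: S_def f.diff smul)
    hence "ip x z = f x * of_real ((norm z)\<^sup>2)"
      by (simp only: ip_diff_left ip_smul_left ip_self) simp
    thus "f x = ip x ((1 / (norm z)\<^sup>2) *\<^sub>R z)"
      using z0 by (simp add: ip_scaleR_right scaleR_conv_of_real)
  qed
qed

text \<open>
  The partial sum \<open>p\<close> of the expansion of \<open>x\<close> is orthogonal to \<open>x - p\<close>, hence not longer than \<open>x\<close>.
\<close>

lemma bessel:
  assumes "orthonormal ip e"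
  shows "summable (\<lambda>i. (norm (ip x (e i)))\<^sup>2)"
proof (rule summableI_nonneg_bounded)
  fix n
  define p where "p = (\<Sum>i<n. ip x (e i) \<odot> e i)"
  have "ip p (e j) = ip x (e j)" if "j < n" for j
    using assms that
    by (simp add: p_def ip_sum_left ip_smul_left orthonormal_def if_distrib[of "(*) _"] cong: if_cong)
  hence "ip (e j) (x - p) = 0" if "j < n" for j
    using that by (subst ip_eq_0_commute) (simp add: ip_diff_left)
  hence "ip p (x - p) = 0"
    by (subst p_def) (simp add: ip_sum_left ip_smul_left)
  from pythagoras[OF this] have "(norm x)\<^sup>2 \<ge> (norm p)\<^sup>2"
    by simp
  thus "(\<Sum>i<n. (norm (ip x (e i)))\<^sup>2) \<le> (norm x)\<^sup>2"
    by (simp add: p_def norm_sum_orthonormal[OF assms])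
qed simp

lemma ip_suminf_orthonormal:
  assumes "orthonormal ip e" "summable (\<lambda>i. a i \<odot> e i)"
  shows "ip (\<Sum>i. a i \<odot> e i) (e j) = a j"
proof -
  have "(\<lambda>i. a i * ip (e i) (e j)) = (\<lambda>i. if i = j then a i else 0)"
    using assms(1) by (auto simp: orthonormal_def)
  thus ?thesis
    using bounded_linear.suminf[OF bounded_linear_ip assms(2), of "e j"]
      suminf_finite[of "{j}" "\<lambda>i. if i = j then a i else 0"]
    by (simp add: ip_smul_left)
qed

lemma orthogonal_closure_span:
  assumes "\<And>i. ip (e i) w = 0" "z \<in> closure (span (range e))"
  shows "ip z w = 0"
proof -
  have "span (range e) \<subseteq> {z. ip z w = 0}"
    using assms(1)
    by (intro span_minimal) (auto simp: subspace_def ip_zero_left ip_add_left ip_smul_left)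
  moreover have "closed {z. ip z w = 0}"
    by (intro closed_Collect_eq continuous_intros bounded_linear.continuous_on[OF bounded_linear_ip])
  ultimately show ?thesis
    using assms(2) closure_minimal by blast
qed

end

section \<open>The adjoint and the coefficients of the Tikhonov error\<close>

lemma hilbert_adjoint_ip:
  assumes "hilbert_space smulX ipX" and "hilbert_space smulY ipY"
    and "Vector_Spaces.linear smulX smulY A" and "bounded_linear A"
  shows "ipY (A x) y = ipX x (hilbert_adjoint ipX ipY A y)"
proof -
  interpret X: hilbert_space smulX ipX by fact
  interpret Y: hilbert_space smulY ipY by fact
  interpret A: Vector_Spaces.linear smulX smulY A by fact
  have "\<exists>b. \<forall>x. ipY (A x) y = ipX x b" for y
  proof -
    have "bounded_linear (\<lambda>x. ipY (A x) y)"
      using bounded_linear_compose[OF Y.bounded_linear_ip assms(4)] .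
    then obtain b where "\<And>x. ipY (A x) y = ipX x b"
      using X.riesz_representation[of "\<lambda>x. ipY (A x) y"] by (auto simp: A.scale Y.ip_smul_left)
    thus ?thesis by blast
  qed
  then obtain B where B: "\<forall>x y. ipY (A x) y = ipX x (B y)"
    by metis
  have "B' = B" if "\<forall>x y. ipY (A x) y = ipX x (B' y)" for B'
  proof
    fix y
    have "ipX (B' y - B y) (B' y - B y) = 0"
      using B that by (simp add: X.ip_diff_right)
    thus "B' y = B y"
      by (simp only: X.ip_self_eq_0_iff) simp
  qed
  hence "hilbert_adjoint ipX ipY A = B"
    unfolding hilbert_adjoint_def using B by (intro the_equality) auto
  with B show ?thesis by simp
qed

lemma compact_operator_bounded_linear:
  assumes "hilbert_space smulX ipX" and "hilbert_space smulY ipY"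
    and "Vector_Spaces.linear smulX smulY A" and "compact_operator A"
  shows "bounded_linear A"
proof -
  interpret X: hilbert_space smulX ipX by fact
  interpret Y: hilbert_space smulY ipY by fact
  interpret A: Vector_Spaces.linear smulX smulY A by fact
  have scaleR: "A (r *\<^sub>R x) = r *\<^sub>R A x" for r x
    by (simp add: A.scale flip: X.smul_of_real Y.smul_of_real)
  have "bounded (A ` cball 0 1)"
    using assms(4) compact_imp_bounded bounded_subset closure_subset
    unfolding compact_operator_def by (metis bounded_cball)
  then obtain M where "\<forall>y\<in>A ` cball 0 1. norm y \<le> M"
    unfolding bounded_iff by blast
  hence M: "norm (A x) \<le> M" if "norm x \<le> 1" for x
    using that by simp
  have "norm (A x) \<le> norm x * M" for x
  proof (cases "x = 0")
    case False
    have "norm (A ((1 / norm x) *\<^sub>R x)) \<le> M"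
      using False by (intro M) simp
    thus ?thesis
      using False unfolding scaleR by (simp add: field_simps)
  qed (simp add: A.zero)
  thus ?thesis
    by (intro bounded_linear_intro[of A M]) (auto simp: A.add scaleR)
qed

text \<open>
  The normal equation forces the coefficients of its solutions, because \<open>A\<^sup>*A\<close> acts on the
  \<open>v i\<close>-component as multiplication by \<open>(\<sigma> i)\<^sup>2\<close>. The substance is that a solution exists, so that \<^const>\<open>inv\<close> in
  \<^const>\<open>tikhonov\<close> yields one. The solution \<open>z\<close> is the series with the coefficients that it must
  have. Its residual is orthogonal to every \<open>v i\<close>, and such a vector is 0: it is orthogonal to the
  range of \<open>A\<^sup>*\<close>, hence in the kernel of \<open>A\<close>, which is trivial.
\<close>

lemma tikhonov_coefficient:
  assumes X: "hilbert_space smulX ipX" and Y: "hilbert_space smulY ipY"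
    and lin: "Vector_Spaces.linear smulX smulY A" and cpt: "compact_operator A" and inj: "inj A"
    and sing: "singular_system smulX ipX smulY ipY A \<sigma> u v"
    and \<alpha>: "0 < \<alpha>"
  shows "ipX (tikhonov ipX ipY A (A x) \<alpha> - x) (v i)
    = of_real (- (\<alpha> / ((\<sigma> i)\<^sup>2 + \<alpha>))) * ipX x (v i)"
proof -
  interpret X: hilbert_space smulX ipX by fact
  interpret Y: hilbert_space smulY ipY by fact
  interpret A: Vector_Spaces.linear smulX smulY A by fact
  define B where "B = hilbert_adjoint ipX ipY A"
  define T where "T = (\<lambda>x. B (A x) + \<alpha> *\<^sub>R x)"
  have adj: "ipY (A x) y = ipX x (B y)" for x y
    unfolding B_def
    using hilbert_adjoint_ip[OF X Y lin compact_operator_bounded_linear[OF X Y lin cpt]] .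
  have adj': "ipX (B y) x = ipY y (A x)" for x y
    by (metis adj X.ip_commute Y.ip_commute)
  have orth: "orthonormal ipX v" and span: "closure (X.span (range v)) = closure (range B)"
    and Av: "A (v i) = \<sigma> i *\<^sub>R u i" and Bu: "B (u i) = \<sigma> i *\<^sub>R v i" for i
    using sing by (auto simp: singular_system_def orthonormal_basis_def B_def)
  have BA: "ipX (B (A z)) (v i) = (\<sigma> i)\<^sup>2 *\<^sub>R ipX z (v i)" for z i
    by (simp add: adj' Av Y.ip_scaleR_right adj Bu X.ip_scaleR_right power2_eq_square)
  have complete: "w = 0" if "\<And>i. ipX w (v i) = 0" for w
  proof -
    have "ipX (v i) w = 0" for i
      using that X.ip_eq_0_commute by blast
    hence "ipX (B (A w)) w = 0"
      using X.orthogonal_closure_span[of v w "B (A w)"] span closure_subset[of "range B"] by blast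
    hence "A w = 0"
      by (simp add: adj' Y.ip_self_eq_0_iff)
    with inj A.zero show ?thesis
      by (metis injD)
  qed
  define a where "a i = of_real ((\<sigma> i)\<^sup>2 / ((\<sigma> i)\<^sup>2 + \<alpha>)) * ipX x (v i)" for i
  have pos: "0 < (\<sigma> i)\<^sup>2 + \<alpha>" for i
    using \<alpha> by (simp add: add_nonneg_pos)
  \<comment> \<open>The filter factor is at most 1, so the series inherits its convergence from Bessel's inequality.\<close>
  have "summable (\<lambda>i. (norm (a i))\<^sup>2)"
  proof (rule summable_comparison_test'[OF X.bessel[OF orth, of x]])
    fix n
    have "norm (a n) = (\<sigma> n)\<^sup>2 / ((\<sigma> n)\<^sup>2 + \<alpha>) * norm (ipX x (v n))"
      using pos[of n] unfolding a_def norm_mult norm_of_real by simp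
    also have "\<dots> \<le> norm (ipX x (v n))"
      using pos[of n] \<alpha> by (intro mult_left_le_one_le) auto
    finally have "norm (a n) \<le> norm (ipX x (v n))" .
    thus "norm ((norm (a n))\<^sup>2) \<le> (norm (ipX x (v n)))\<^sup>2"
      by (simp add: power_mono)
  qed
  hence sm: "summable (\<lambda>i. smulX (a i) (v i))"
    by (simp add: X.summable_orthonormal_iff[OF orth])
  define z where "z = (\<Sum>i. smulX (a i) (v i))"
  have "T z - B (A x) = 0"
  proof (rule complete)
    fix i
    have "ipX z (v i) = a i"
      unfolding z_def by (rule X.ip_suminf_orthonormal[OF orth sm])
    hence "ipX (T z - B (A x)) (v i) = ((\<sigma> i)\<^sup>2 + \<alpha>) *\<^sub>R a i - (\<sigma> i)\<^sup>2 *\<^sub>R ipX x (v i)"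
      by (simp add: T_def X.ip_diff_left X.ip_add_left X.ip_scaleR_left BA scaleR_add_left)
    also have "\<dots> = 0"
    proof -
      have "a i = ((\<sigma> i)\<^sup>2 / ((\<sigma> i)\<^sup>2 + \<alpha>)) *\<^sub>R ipX x (v i)"
        by (simp only: a_def scaleR_conv_of_real)
      thus ?thesis
        using pos[of i] by simp
    qed
    finally show "ipX (T z - B (A x)) (v i) = 0" .
  qed
  hence "B (A x) \<in> range T"
    by (metis eq_iff_diff_eq_0 rangeI)
  hence "T (tikhonov ipX ipY A (A x) \<alpha>) = B (A x)"
    unfolding tikhonov_def T_def B_def by (rule f_inv_into_f)
  hence "ipX (T (tikhonov ipX ipY A (A x) \<alpha>)) (v i) = ipX (B (A x)) (v i)"
    by simp
  hence "((\<sigma> i)\<^sup>2 + \<alpha>) *\<^sub>R ipX (tikhonov ipX ipY A (A x) \<alpha> - x) (v i) = (- \<alpha>) *\<^sub>R ipX x (v i)"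
    by (simp add: T_def X.ip_add_left X.ip_diff_left X.ip_scaleR_left BA algebra_simps)
  hence "ipX (tikhonov ipX ipY A (A x) \<alpha> - x) (v i)
      = (1 / ((\<sigma> i)\<^sup>2 + \<alpha>)) *\<^sub>R ((- \<alpha>) *\<^sub>R ipX x (v i))"
    using pos[of i] by (metis scaleR_scaleR scaleR_one nonzero_divide_eq_eq less_irrefl mult.commute)
  thus ?thesis
    by (simp add: scaleR_conv_of_real)
qed

section \<open>Reweighting masses by powers\<close>

text \<open>
  This is the distribution function of the measure with mass \<open>w n\<close> at the point \<open>s n\<close>. It is
  extended-valued because a weighted sequence need not be summable a priori.
\<close>

definition mass_below :: "(nat \<Rightarrow> real) \<Rightarrow> (nat \<Rightarrow> real) \<Rightarrow> real \<Rightarrow> ennreal" where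
  "mass_below s w t = (\<Sum>n. ennreal (w n) * indicator {n. s n \<le> t} n)"

lemma ennreal_suminf_swap:
  fixes f :: "nat \<Rightarrow> nat \<Rightarrow> ennreal"
  shows "(\<Sum>i. \<Sum>j. f i j) = (\<Sum>j. \<Sum>i. f i j)"
proof -
  have "(\<Sum>i. \<Sum>j. f i j) = (\<Sum>i. \<integral>\<^sup>+ j. f i j \<partial>count_space UNIV)"
    by (simp add: nn_integral_count_space_nat)
  also have "\<dots> = (\<integral>\<^sup>+ j. (\<Sum>i. f i j) \<partial>count_space UNIV)"
    by (rule nn_integral_suminf[symmetric]) simp
  finally show ?thesis
    by (simp add: nn_integral_count_space_nat)
qed

lemma powr_comparable:
  fixes a b q :: real
  assumes "0 < a" "a \<le> b" "b \<le> 2 * a"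
  shows "a powr q \<le> 2 powr \<bar>q\<bar> * b powr q"
proof (cases "q \<ge> 0")
  case True
  have "1 * a powr q \<le> 2 powr \<bar>q\<bar> * b powr q"
    using assms True by (intro mult_mono powr_mono2 ge_one_powr_ge_zero) auto
  thus ?thesis by simp
next
  case False
  have "(2 * a) powr q \<le> b powr q"
    using assms False by (intro powr_mono2') auto
  hence "2 powr (-q) * (2 powr q * a powr q) \<le> 2 powr (-q) * b powr q"
    using assms by (intro mult_left_mono) (auto simp: powr_mult)
  thus ?thesis
    using False by (simp add: mult.assoc[symmetric] flip: powr_add)
qed

text \<open>
  Each index of \<open>S\<close> is charged to a scale \<open>\<tau> j = t r\<^sup>j\<close> that is comparable to \<open>s n\<close>; there the weight
  \<open>s n powr q\<close> may be replaced by \<open>\<tau> j powr q\<close>. Interchanging the sums over \<open>n\<close> and \<open>j\<close> leaves a geometric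
  series with ratio \<open>r powr (p + q)\<close>. The ratio \<open>r\<close> is kept arbitrary in order to cover scales that
  shrink to 0 (\<open>r = 1/2\<close>) and scales that grow (\<open>r = 2\<close>) at once.
\<close>

lemma geometric_shells_sum:
  fixes s w :: "nat \<Rightarrow> real" and t r p q C :: real
  assumes s: "\<And>n. 0 < s n" and w: "\<And>n. 0 \<le> w n" and "0 < t" "0 < r" "0 \<le> C"
    and ratio: "r powr (p + q) < 1"
    and shell: "\<And>n. n \<in> S \<Longrightarrow> \<exists>j. s n \<le> t * r ^ j \<and> t * r ^ j \<le> 2 * s n"
    and mass: "\<And>j. mass_below s w (t * r ^ j) \<le> ennreal (C * (t * r ^ j) powr p)"
  shows "(\<Sum>n. ennreal (s n powr q * w n) * indicator S n)
    \<le> ennreal (2 powr \<bar>q\<bar> / (1 - r powr (p + q)) * C * t powr (p + q))"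
proof -
  define \<tau> where "\<tau> j = t * r ^ j" for j
  define K where "K = 2 powr \<bar>q\<bar>"
  have \<tau>: "0 < \<tau> j" for j
    using assms by (simp add: \<tau>_def)
  have "ennreal (s n powr q * w n) * indicator S n
      \<le> (\<Sum>j. ennreal (K * \<tau> j powr q) * (ennreal (w n) * indicator {n. s n \<le> \<tau> j} n))" for n
  proof (cases "n \<in> S")
    case True
    then obtain j where j: "s n \<le> \<tau> j" "\<tau> j \<le> 2 * s n"
      using shell by (auto simp: \<tau>_def)
    have "ennreal (s n powr q * w n) \<le> ennreal (K * \<tau> j powr q * w n)"
      using powr_comparable[OF s j, of q] w
      by (intro ennreal_leI mult_right_mono) (auto simp: K_def)
    also have "\<dots> = (\<Sum>i\<in>{j}. ennreal (K * \<tau> i powr q) * (ennreal (w n) * indicator {n. s n \<le> \<tau> i} n))"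
      using j w by (simp add: ennreal_mult K_def)
    also have "\<dots> \<le> (\<Sum>i. ennreal (K * \<tau> i powr q) * (ennreal (w n) * indicator {n. s n \<le> \<tau> i} n))"
      by (intro sum_le_suminf) auto
    finally show ?thesis
      using True by simp
  qed simp
  hence "(\<Sum>n. ennreal (s n powr q * w n) * indicator S n)
      \<le> (\<Sum>n. \<Sum>j. ennreal (K * \<tau> j powr q) * (ennreal (w n) * indicator {n. s n \<le> \<tau> j} n))"
    by (intro suminf_le) auto
  also have "\<dots> = (\<Sum>j. \<Sum>n. ennreal (K * \<tau> j powr q) * (ennreal (w n) * indicator {n. s n \<le> \<tau> j} n))"
    by (rule ennreal_suminf_swap)
  also have "\<dots> = (\<Sum>j. ennreal (K * \<tau> j powr q) * mass_below s w (\<tau> j))"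
    by (simp add: mass_below_def)
  also have "\<dots> \<le> (\<Sum>j. ennreal (K * \<tau> j powr q) * ennreal (C * \<tau> j powr p))"
    using mass by (intro suminf_le mult_left_mono) (auto simp: \<tau>_def)
  also have "\<dots> = (\<Sum>j. ennreal (K * C * t powr (p + q) * (r powr (p + q)) ^ j))"
  proof -
    have "ennreal (K * \<tau> j powr q) * ennreal (C * \<tau> j powr p)
        = ennreal (K * C * t powr (p + q) * (r powr (p + q)) ^ j)" for j
    proof -
      have "(K * \<tau> j powr q) * (C * \<tau> j powr p) = K * C * \<tau> j powr (p + q)"
        by (simp add: powr_add)
      also have "\<tau> j powr (p + q) = t powr (p + q) * (r powr (p + q)) ^ j"
        using assms by (simp add: \<tau>_def powr_mult powr_powr mult.commute flip: powr_realpow)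
      finally show ?thesis
        using \<open>0 \<le> C\<close> by (simp add: K_def ennreal_mult'[symmetric] mult.assoc)
    qed
    thus ?thesis by simp
  qed
  also have "\<dots> = ennreal (K * C * t powr (p + q) * (1 / (1 - r powr (p + q))))"
    using ratio \<open>0 \<le> C\<close>
    by (subst suminf_ennreal2) (auto simp: K_def suminf_mult suminf_geometric summable_geometric intro!: summable_mult)
  finally show ?thesis
    by (simp add: K_def mult_ac)
qed

lemma mass_below_reweight:
  fixes s w :: "nat \<Rightarrow> real"
  assumes s: "\<And>n. 0 < s n" and w: "\<And>n. 0 \<le> w n" and "0 < t" "0 \<le> C" "0 < p + q"
    and mass: "\<And>\<tau>. 0 < \<tau> \<Longrightarrow> \<tau> \<le> t \<Longrightarrow> mass_below s w \<tau> \<le> ennreal (C * \<tau> powr p)"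
  shows "mass_below s (\<lambda>n. s n powr q * w n) t
    \<le> ennreal (2 powr \<bar>q\<bar> / (1 - (1/2) powr (p + q)) * C * t powr (p + q))"
  unfolding mass_below_def
proof (rule geometric_shells_sum[OF s w])
  show "(1/2) powr (p + q) < (1::real)"
    using powr_less_mono2[of "p + q" "1/2" 1] \<open>0 < p + q\<close> by simp
  show "mass_below s w (t * (1/2) ^ j) \<le> ennreal (C * (t * (1/2) ^ j) powr p)" for j
    using \<open>0 < t\<close> by (intro mass) (auto simp: mult_le_cancel_left1 power_le_one)
  \<comment> \<open>The last scale that is still at least \<open>s n\<close>.\<close>
  show "\<exists>j. s n \<le> t * (1/2) ^ j \<and> t * (1/2) ^ j \<le> 2 * s n" if "n \<in> {n. s n \<le> t}" for n
  proof -
    let ?P = "\<lambda>j. t * (1/2) ^ j < s n"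
    obtain j where "(1/2) ^ j < s n / t"
      using real_arch_pow_inv[of "s n / t" "1/2"] s \<open>0 < t\<close> by auto
    hence P: "\<exists>j. ?P j"
      using \<open>0 < t\<close> by (auto simp: field_simps)
    have "\<not> ?P 0"
      using that by simp
    then obtain i where i: "Suc i = (LEAST j. ?P j)"
      using LeastI_ex[OF P] by (metis not0_implies_Suc)
    have "?P (Suc i)" "\<not> ?P i"
      using LeastI_ex[OF P] i not_less_Least[of i ?P] by auto
    thus ?thesis
      by (intro exI[of _ i]) auto
  qed
qed (use assms in auto)

lemma mass_above_reweight:
  fixes s w :: "nat \<Rightarrow> real"
  assumes s: "\<And>n. 0 < s n" and w: "\<And>n. 0 \<le> w n" and "0 < t" "0 \<le> C" "p + q < 0"
    and mass: "\<And>\<tau>. t \<le> \<tau> \<Longrightarrow> mass_below s w \<tau> \<le> ennreal (C * \<tau> powr p)"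
  shows "(\<Sum>n. ennreal (s n powr q * w n) * indicator {n. t < s n} n)
    \<le> ennreal (2 powr \<bar>q\<bar> / (1 - 2 powr (p + q)) * C * t powr (p + q))"
proof (rule geometric_shells_sum[OF s w])
  show "2 powr (p + q) < (1::real)"
    using assms powr_less_mono[of "p + q" 0 2] by simp
  show "mass_below s w (t * 2 ^ j) \<le> ennreal (C * (t * 2 ^ j) powr p)" for j
    using \<open>0 < t\<close> by (intro mass) (auto simp: mult_le_cancel_left1)
  \<comment> \<open>The first scale that is at least \<open>s n\<close>.\<close>
  show "\<exists>j. s n \<le> t * 2 ^ j \<and> t * 2 ^ j \<le> 2 * s n" if "n \<in> {n. t < s n}" for n
  proof -
    let ?P = "\<lambda>j. s n \<le> t * 2 ^ j"
    obtain j where "s n / t < 2 ^ j"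
      using real_arch_pow[of 2 "s n / t"] by auto
    hence P: "\<exists>j. ?P j"
      using \<open>0 < t\<close> by (auto simp: field_simps intro: less_imp_le)
    have "\<not> ?P 0"
      using that by simp
    then obtain i where i: "Suc i = (LEAST j. ?P j)"
      using LeastI_ex[OF P] by (metis not0_implies_Suc)
    have "?P (Suc i)" "\<not> ?P i"
      using LeastI_ex[OF P] i not_less_Least[of i ?P] by auto
    thus ?thesis
      by (intro exI[of _ "Suc i"]) auto
  qed
qed (use assms in auto)

section \<open>Tails and masses\<close>

lemma suminf_tail_eq_ennreal:
  fixes c :: "nat \<Rightarrow> real"
  assumes "\<And>n. 0 \<le> c n" "summable c"
  shows "ennreal (\<Sum>n. c (k + n)) = (\<Sum>n. ennreal (c n) * indicator {k..} n)"
proof -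
  have "(\<Sum>n. ennreal (c n) * indicator {k..} n)
      = (\<Sum>n. ennreal (c (n + k)) * indicator {k..} (n + k)) + (\<Sum>n<k. ennreal (c n) * indicator {k..} n)"
    by (rule suminf_offset) simp
  also have "(\<Sum>n<k. ennreal (c n) * indicator {k..} n) = 0"
    by (intro sum.neutral) auto
  also have "(\<Sum>n. ennreal (c (n + k)) * indicator {k..} (n + k)) = (\<Sum>n. ennreal (c (k + n)))"
    by (simp add: add.commute)
  also have "\<dots> = ennreal (\<Sum>n. c (k + n))"
    using assms summable_ignore_initial_segment[OF assms(2), of k]
    by (intro suminf_ennreal2) (auto simp: add.commute)
  finally show ?thesis by simp
qed

text \<open>
  For the first index \<open>k\<close> with \<open>s k \<le> t\<close> the mass below \<open>t\<close> is the tail from \<open>k\<close>. Conversely, the tail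
  from \<open>k\<close> is at most the mass below \<open>s k\<close>; if \<open>s\<close> takes the value \<open>s k\<close> several times, that mass may be
  larger.
\<close>

lemma tails_bigo_iff_mass_below:
  fixes s c :: "nat \<Rightarrow> real"
  assumes "antimono s" and s: "\<And>n. 0 < s n" and lim: "s \<longlonglongrightarrow> 0"
    and c: "\<And>n. 0 \<le> c n" "summable c" and "0 < p"
  shows "(\<lambda>k. \<Sum>n. c (k + n)) \<in> O(\<lambda>k. s k powr p)
    \<longleftrightarrow> (\<exists>C\<ge>0. \<exists>t\<^sub>0>0. \<forall>t. 0 < t \<and> t \<le> t\<^sub>0 \<longrightarrow> mass_below s c t \<le> ennreal (C * t powr p))"
    (is "?L \<longleftrightarrow> ?R")
proof
  assume ?L
  then obtain C where C: "C > 0" "eventually (\<lambda>k. norm (\<Sum>n. c (k + n)) \<le> C * norm (s k powr p)) sequentially"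
    by (elim landau_o.bigE)
  then obtain k\<^sub>0 where k\<^sub>0: "\<And>k. k \<ge> k\<^sub>0 \<Longrightarrow> (\<Sum>n. c (k + n)) \<le> C * s k powr p"
    by (fastforce simp: eventually_sequentially)
  have "mass_below s c t \<le> ennreal (C * t powr p)" if t: "0 < t" "t < s k\<^sub>0" for t
  proof -
    have ex: "\<exists>k. s k \<le> t"
      using order_tendstoD(2)[OF lim t(1)] by (auto simp: eventually_sequentially intro: less_imp_le)
    define k where "k = (LEAST k. s k \<le> t)"
    have k: "s k \<le> t"
      unfolding k_def by (rule LeastI_ex[OF ex])
    hence "k \<ge> k\<^sub>0"
      using t antimonoD[OF \<open>antimono s\<close>, of k k\<^sub>0] by (cases "k \<ge> k\<^sub>0") auto
    have "{n. s n \<le> t} \<subseteq> {k..}"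
      by (auto simp: k_def intro: Least_le)
    hence "mass_below s c t \<le> (\<Sum>n. ennreal (c n) * indicator {k..} n)"
      unfolding mass_below_def by (intro suminf_le mult_left_mono) (auto simp: indicator_def)
    also have "\<dots> = ennreal (\<Sum>n. c (k + n))"
      using suminf_tail_eq_ennreal[OF c] by simp
    also have "\<dots> \<le> ennreal (C * s k powr p)"
      using k\<^sub>0 \<open>k \<ge> k\<^sub>0\<close> by (intro ennreal_leI)
    also have "\<dots> \<le> ennreal (C * t powr p)"
      using C(1) k s[of k] \<open>0 < p\<close> by (intro ennreal_leI mult_left_mono powr_mono2) auto
    finally show ?thesis .
  qed
  moreover have "0 < s k\<^sub>0 / 2" "s k\<^sub>0 / 2 < s k\<^sub>0"
    using s[of k\<^sub>0] by auto
  ultimately show ?R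
    using C(1) by (metis less_imp_le le_less_trans)
next
  assume ?R
  then obtain C t\<^sub>0 where C: "C \<ge> 0" "t\<^sub>0 > 0"
    and mass: "\<And>t. 0 < t \<Longrightarrow> t \<le> t\<^sub>0 \<Longrightarrow> mass_below s c t \<le> ennreal (C * t powr p)"
    by blast
  have "(\<Sum>n. c (k + n)) \<le> C * s k powr p" if "s k < t\<^sub>0" for k
  proof -
    have "ennreal (\<Sum>n. c (k + n)) = (\<Sum>n. ennreal (c n) * indicator {k..} n)"
      using suminf_tail_eq_ennreal[OF c] .
    also have "\<dots> \<le> mass_below s c (s k)"
      unfolding mass_below_def using \<open>antimono s\<close>
      by (intro suminf_le mult_left_mono) (auto simp: indicator_def dest: antimonoD)
    also have "\<dots> \<le> ennreal (C * s k powr p)"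
      using that s by (intro mass) auto
    finally show ?thesis
      using C(1) by (subst (asm) ennreal_le_iff) auto
  qed
  moreover have "0 \<le> (\<Sum>n. c (k + n))" for k
    using c summable_ignore_initial_segment[OF c(2), of k]
    by (intro suminf_nonneg) (auto simp: add.commute)
  ultimately show ?L
    using order_tendstoD(2)[OF lim C(2)] by (intro landau_o.bigI[of C] bigoI[of _ C]) (auto elim!: eventually_mono)
qed

text \<open>
  The part of the Tikhonov error above the scale \<open>\<alpha>\<close> involves all larger scales, so a bound near 0 is
  not enough for it; the finite total mass provides the bound for large \<open>t\<close>.
\<close>

lemma mass_below_global_bound:
  fixes s c :: "nat \<Rightarrow> real"
  assumes c: "\<And>n. 0 \<le> c n" "summable c" and "0 < p" "0 \<le> C" "0 < t\<^sub>0"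
    and mass: "\<And>t. 0 < t \<Longrightarrow> t \<le> t\<^sub>0 \<Longrightarrow> mass_below s c t \<le> ennreal (C * t powr p)"
  obtains D where "0 \<le> D" "\<And>t. 0 < t \<Longrightarrow> mass_below s c t \<le> ennreal (D * t powr p)"
proof
  define D where "D = max C (suminf c / t\<^sub>0 powr p)"
  show "0 \<le> D"
    using assms by (simp add: D_def)
  show "mass_below s c t \<le> ennreal (D * t powr p)" if "0 < t" for t
  proof (cases "t \<le> t\<^sub>0")
    case True
    have "C * t powr p \<le> D * t powr p"
      by (intro mult_right_mono) (auto simp: D_def)
    with mass[OF that True] show ?thesis
      by (meson ennreal_leI order_trans)
  next
    case False
    have "mass_below s c t \<le> (\<Sum>n. ennreal (c n))"
      unfolding mass_below_def by (intro suminf_le) (auto simp: indicator_def)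
    also have "\<dots> = ennreal (suminf c)"
      using c by (rule suminf_ennreal2)
    also have "suminf c = suminf c / t\<^sub>0 powr p * t\<^sub>0 powr p"
      using \<open>0 < t\<^sub>0\<close> by simp
    also have "\<dots> \<le> D * t powr p"
      using False assms suminf_nonneg[OF c(2,1)]
      by (intro mult_mono powr_mono2) (auto simp: D_def)
    finally show ?thesis
      by (simp add: ennreal_leI)
  qed
qed

section \<open>The equivalence of the two rates\<close>

text \<open>
  From left to right, keeping only \<open>s n \<le> \<alpha>\<close> bounds the mass of the weighted sequence \<open>w\<close>, and the
  weight is then removed by reweighting with \<open>q = -2\<nu>\<close>. From right to left, the sum is split at \<open>\<alpha>\<close>
  and the weights are \<open>q = 2\<nu>\<close> below and \<open>q = 2\<nu> - 2\<close> above \<open>\<alpha>\<close>, the \<open>-2\<close> coming from the filter factor.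
\<close>

lemma filtered_sum_bound_iff_mass_below:
  fixes s c :: "nat \<Rightarrow> real" and \<mu> \<nu> :: real
  assumes s: "\<And>n. 0 < s n" and c: "\<And>n. 0 \<le> c n" "summable c"
    and \<mu>: "0 < \<mu>" "0 < \<mu> + \<nu>" "\<mu> + \<nu> < 1"
  defines "F \<equiv> \<lambda>\<alpha>. \<Sum>n. ennreal (s n powr (2 * \<nu>) * ((\<alpha> / (s n + \<alpha>))\<^sup>2 * c n))"
  shows "(\<exists>C>0. \<exists>\<alpha>\<^sub>0>0. \<forall>\<alpha>. 0 < \<alpha> \<and> \<alpha> \<le> \<alpha>\<^sub>0 \<longrightarrow> F \<alpha> \<le> ennreal (C * \<alpha> powr (2 * (\<nu> + \<mu>))))
    \<longleftrightarrow> (\<exists>C\<ge>0. \<exists>t\<^sub>0>0. \<forall>t. 0 < t \<and> t \<le> t\<^sub>0 \<longrightarrow> mass_below s c t \<le> ennreal (C * t powr (2 * \<mu>)))"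
    (is "?L \<longleftrightarrow> ?R")
proof
  assume ?L
  then obtain C \<alpha>\<^sub>0 where C: "C > 0" "\<alpha>\<^sub>0 > 0"
    and F: "\<And>\<alpha>. 0 < \<alpha> \<Longrightarrow> \<alpha> \<le> \<alpha>\<^sub>0 \<Longrightarrow> F \<alpha> \<le> ennreal (C * \<alpha> powr (2 * (\<nu> + \<mu>)))"
    by blast
  define w where "w n = s n powr (2 * \<nu>) * c n" for n
  have w: "0 \<le> w n" for n
    using c by (simp add: w_def)
  have mass: "mass_below s w \<alpha> \<le> ennreal (4 * C * \<alpha> powr (2 * (\<nu> + \<mu>)))"
    if \<alpha>: "0 < \<alpha>" "\<alpha> \<le> \<alpha>\<^sub>0" for \<alpha>
  proof -
    have "ennreal (w n) * indicator {n. s n \<le> \<alpha>} n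
        \<le> ennreal 4 * ennreal (s n powr (2 * \<nu>) * ((\<alpha> / (s n + \<alpha>))\<^sup>2 * c n))" for n
    proof (cases "s n \<le> \<alpha>")
      case True
      have "1/2 \<le> \<alpha> / (s n + \<alpha>)"
        using True s[of n] \<alpha> by (simp add: field_simps)
      hence "(1/2)\<^sup>2 \<le> (\<alpha> / (s n + \<alpha>))\<^sup>2"
        by (intro power_mono) auto
      hence "1 * w n \<le> (4 * (\<alpha> / (s n + \<alpha>))\<^sup>2) * w n"
        by (intro mult_right_mono w) (simp add: power_divide mult_ac)
      hence "w n \<le> 4 * (s n powr (2 * \<nu>) * ((\<alpha> / (s n + \<alpha>))\<^sup>2 * c n))"
        by (simp add: w_def mult_ac)
      from ennreal_leI[OF this] show ?thesis
        using True c by (simp add: ennreal_mult)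
    qed simp
    hence "mass_below s w \<alpha> \<le> ennreal 4 * F \<alpha>"
      unfolding mass_below_def F_def ennreal_suminf_cmult[symmetric] by (intro suminf_le) auto
    also have "\<dots> \<le> ennreal 4 * ennreal (C * \<alpha> powr (2 * (\<nu> + \<mu>)))"
      using F \<alpha> by (intro mult_left_mono) auto
    also have "\<dots> = ennreal (4 * C * \<alpha> powr (2 * (\<nu> + \<mu>)))"
      using C by (subst ennreal_mult[symmetric]) (auto simp: mult_ac)
    finally show ?thesis .
  qed
  have c_eq: "s n powr (- (2 * \<nu>)) * w n = c n" for n
    using s[of n] by (simp add: w_def mult.assoc[symmetric] flip: powr_add)
  define D where "D = 2 powr \<bar>- (2 * \<nu>)\<bar> / (1 - (1/2) powr (2 * \<mu>)) * (4 * C)"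
  have "mass_below s c t \<le> ennreal (D * t powr (2 * \<mu>))" if "0 < t" "t \<le> \<alpha>\<^sub>0" for t
  proof -
    have e: "2 * (\<nu> + \<mu>) + - (2 * \<nu>) = 2 * \<mu>"
      by simp
    have "mass_below s (\<lambda>n. s n powr - (2 * \<nu>) * w n) t
        \<le> ennreal (2 powr \<bar>- (2 * \<nu>)\<bar> / (1 - (1/2) powr (2 * (\<nu> + \<mu>) + - (2 * \<nu>))) * (4 * C)
              * t powr (2 * (\<nu> + \<mu>) + - (2 * \<nu>)))"
      by (rule mass_below_reweight[OF s w]) (use that C \<mu> mass in \<open>auto simp del: mult_minus_left\<close>)
    thus ?thesis
      by (simp only: c_eq e D_def)
  qed
  moreover have "D \<ge> 0"
    using C \<mu> by (auto simp: D_def intro!: mult_nonneg_nonneg divide_nonneg_nonneg powr_le1)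
  ultimately show ?R
    using C(2) by blast
next
  assume ?R
  then obtain C where C: "C \<ge> 0"
    and mass: "\<And>t. 0 < t \<Longrightarrow> mass_below s c t \<le> ennreal (C * t powr (2 * \<mu>))"
    using mass_below_global_bound[OF c, of "2 * \<mu>"] \<mu>(1) by (metis mult_pos_pos zero_less_numeral)
  define D\<^sub>1 where "D\<^sub>1 = 2 powr \<bar>2 * \<nu>\<bar> / (1 - (1/2) powr (2 * \<mu> + 2 * \<nu>)) * C"
  define D\<^sub>2 where "D\<^sub>2 = 2 powr \<bar>2 * \<nu> - 2\<bar> / (1 - 2 powr (2 * \<mu> + (2 * \<nu> - 2))) * C"
  have "D\<^sub>1 \<ge> 0" "D\<^sub>2 \<ge> 0"
    using C \<mu> powr_le1[of "2 * \<mu> + 2 * \<nu>" "1/2"] powr_mono[of "2 * \<mu> + (2 * \<nu> - 2)" 0 2]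
    by (auto simp: D\<^sub>1_def D\<^sub>2_def intro!: mult_nonneg_nonneg divide_nonneg_nonneg)
  have "F \<alpha> \<le> ennreal ((D\<^sub>1 + D\<^sub>2 + 1) * \<alpha> powr (2 * (\<nu> + \<mu>)))" if \<alpha>: "0 < \<alpha>" for \<alpha>
  proof -
    let ?lo = "\<lambda>n. ennreal (s n powr (2 * \<nu>) * c n) * indicator {n. s n \<le> \<alpha>} n"
    let ?hi = "\<lambda>n. ennreal (s n powr (2 * \<nu> - 2) * c n) * indicator {n. \<alpha> < s n} n"
    have "ennreal (s n powr (2 * \<nu>) * ((\<alpha> / (s n + \<alpha>))\<^sup>2 * c n))
        \<le> ?lo n + ennreal (\<alpha>\<^sup>2) * ?hi n" for n
    proof (cases "s n \<le> \<alpha>")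
      case True
      have "(\<alpha> / (s n + \<alpha>))\<^sup>2 \<le> 1"
        using s[of n] \<alpha> by (intro power_le_one) (auto simp: field_simps)
      hence "s n powr (2 * \<nu>) * ((\<alpha> / (s n + \<alpha>))\<^sup>2 * c n) \<le> s n powr (2 * \<nu>) * (1 * c n)"
        using c by (intro mult_left_mono mult_right_mono) auto
      with True show ?thesis
        by (simp add: ennreal_leI)
    next
      case False
      have "(\<alpha> / (s n + \<alpha>))\<^sup>2 \<le> (\<alpha> / s n)\<^sup>2"
        using s[of n] \<alpha> by (intro power_mono divide_left_mono) auto
      hence "s n powr (2 * \<nu>) * ((\<alpha> / (s n + \<alpha>))\<^sup>2 * c n) \<le> s n powr (2 * \<nu>) * ((\<alpha> / s n)\<^sup>2 * c n)"
        using c by (intro mult_left_mono mult_right_mono) auto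
      also have "\<dots> = \<alpha>\<^sup>2 * (s n powr (2 * \<nu> - 2) * c n)"
        using s[of n] by (simp add: powr_diff power_divide)
      finally show ?thesis
        using False by (simp add: ennreal_leI flip: ennreal_mult')
    qed
    hence "F \<alpha> \<le> (\<Sum>n. ?lo n + ennreal (\<alpha>\<^sup>2) * ?hi n)"
      unfolding F_def by (intro suminf_le) auto
    also have "\<dots> = (\<Sum>n. ?lo n) + ennreal (\<alpha>\<^sup>2) * (\<Sum>n. ?hi n)"
      by (simp add: suminf_add[symmetric])
    also have "\<dots> \<le> ennreal (D\<^sub>1 * \<alpha> powr (2 * \<mu> + 2 * \<nu>))
        + ennreal (\<alpha>\<^sup>2) * ennreal (D\<^sub>2 * \<alpha> powr (2 * \<mu> + (2 * \<nu> - 2)))"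
      using mass_below_reweight[of s c \<alpha> C "2 * \<mu>" "2 * \<nu>"]
        mass_above_reweight[of s c \<alpha> C "2 * \<mu>" "2 * \<nu> - 2"] s c mass C \<alpha> \<mu>
      unfolding D\<^sub>1_def D\<^sub>2_def mass_below_def
      by (intro add_mono mult_left_mono) (auto simp: mult_ac)
    also have "ennreal (\<alpha>\<^sup>2) * ennreal (D\<^sub>2 * \<alpha> powr (2 * \<mu> + (2 * \<nu> - 2)))
        = ennreal (D\<^sub>2 * \<alpha> powr (2 * \<mu> + 2 * \<nu>))"
    proof -
      have "\<alpha>\<^sup>2 * \<alpha> powr (2 * \<mu> + (2 * \<nu> - 2)) = \<alpha> powr (2 * \<mu> + 2 * \<nu>)"
        using \<alpha> by (simp flip: powr_add powr_numeral)
      thus ?thesis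
        by (simp add: mult.left_commute flip: ennreal_mult')
    qed
    also have "ennreal (D\<^sub>1 * \<alpha> powr (2 * \<mu> + 2 * \<nu>)) + ennreal (D\<^sub>2 * \<alpha> powr (2 * \<mu> + 2 * \<nu>))
        = ennreal ((D\<^sub>1 + D\<^sub>2) * \<alpha> powr (2 * \<mu> + 2 * \<nu>))"
      using \<open>D\<^sub>1 \<ge> 0\<close> \<open>D\<^sub>2 \<ge> 0\<close> by (simp add: distrib_right flip: ennreal_plus)
    also have "\<dots> \<le> ennreal ((D\<^sub>1 + D\<^sub>2 + 1) * \<alpha> powr (2 * (\<nu> + \<mu>)))"
      by (intro ennreal_leI mult_mono) (use \<open>D\<^sub>1 \<ge> 0\<close> \<open>D\<^sub>2 \<ge> 0\<close> in \<open>auto simp: algebra_simps\<close>)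
    finally show ?thesis .
  qed
  \<comment> \<open>The summand 1 makes the constant positive even if \<open>C = 0\<close>.\<close>
  moreover have "D\<^sub>1 + D\<^sub>2 + 1 > 0"
    using \<open>D\<^sub>1 \<ge> 0\<close> \<open>D\<^sub>2 \<ge> 0\<close> by simp
  ultimately show ?L
    by (metis zero_less_one)
qed

theorem theorem2:
  fixes smulX :: "'k::conj_field \<Rightarrow> 'a::banach \<Rightarrow> 'a" and ipX :: "'a \<Rightarrow> 'a \<Rightarrow> 'k"
    and smulY :: "'k \<Rightarrow> 'b::banach \<Rightarrow> 'b" and ipY :: "'b \<Rightarrow> 'b \<Rightarrow> 'k"
    and A :: "'a \<Rightarrow> 'b" and \<sigma> :: "nat \<Rightarrow> real" and u :: "nat \<Rightarrow> 'b" and v :: "nat \<Rightarrow> 'a"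
    and x :: 'a and y :: 'b and \<mu> \<nu> :: real
  assumes "hilbert_space smulX ipX" and "hilbert_space smulY ipY"
    and "Vector_Spaces.linear smulX smulY A" and "compact_operator A" and "inj A"
    and "onorm A = 1"
    and "\<not> (\<exists>B. finite B \<and> range A \<subseteq> module.span smulY B)"
    and "singular_system smulX ipX smulY ipY A \<sigma> u v"
    and "y = A x"
    and "0 < \<mu>" and "0 < \<mu> + \<nu>" and "\<mu> + \<nu> < 1"
  shows "(\<exists>C>0. \<exists>\<alpha>\<^sub>0>0. \<forall>\<alpha>. 0 < \<alpha> \<and> \<alpha> \<le> \<alpha>\<^sub>0 \<longrightarrow>
            spectral_power_norm_sq smulX ipX \<sigma> v \<nu> (tikhonov ipX ipY A y \<alpha> - x)
              \<le> ennreal (C * \<alpha> powr (2 * (\<nu> + \<mu>))))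
         \<longleftrightarrow> (\<lambda>k. \<Sum>n. (norm (ipX x (v (k + n))))\<^sup>2) \<in> O(\<lambda>k. \<sigma> k powr (4 * \<mu>))"
proof -
  interpret X: hilbert_space smulX ipX by fact
  have orth: "orthonormal ipX v" and \<sigma>: "antimono \<sigma>" "0 < \<sigma> i" "\<sigma> \<longlonglongrightarrow> 0" for i
    using assms(8) by (auto simp: singular_system_def orthonormal_basis_def)
  define s where "s n = (\<sigma> n)\<^sup>2" for n
  define c where "c n = (norm (ipX x (v n)))\<^sup>2" for n
  have s: "antimono s" "0 < s i" "s \<longlonglongrightarrow> 0" for i
  proof -
    show "antimono s"
      unfolding s_def using antimonoD[OF \<sigma>(1)] less_imp_le[OF \<sigma>(2)]
      by (intro antimonoI power_mono)
    show "0 < s i"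
      using \<sigma>(2)[of i] by (simp add: s_def)
    show "s \<longlonglongrightarrow> 0"
      using tendsto_power[OF \<sigma>(3), of 2] by (simp add: s_def[abs_def])
  qed
  have c: "0 \<le> c n" "summable c" for n
    using X.bessel[OF orth, of x] by (simp_all add: c_def[abs_def])
  have s_powr: "s n powr p = \<sigma> n powr (2 * p)" for n p
    using \<sigma>(2)[of n] by (simp add: s_def powr_powr flip: powr_numeral)
  have error: "spectral_power_norm_sq smulX ipX \<sigma> v \<nu> (tikhonov ipX ipY A y \<alpha> - x)
      = (\<Sum>n. ennreal (s n powr (2 * \<nu>) * ((\<alpha> / (s n + \<alpha>))\<^sup>2 * c n)))" if "0 < \<alpha>" for \<alpha>
  proof -
    have "(norm (ipX (tikhonov ipX ipY A y \<alpha> - x) (v n)))\<^sup>2 = (\<alpha> / (s n + \<alpha>))\<^sup>2 * c n" for n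
      unfolding \<open>y = A x\<close> tikhonov_coefficient[OF assms(1-5,8) that] norm_mult norm_of_real
      by (simp add: s_def c_def power_mult_distrib power_divide)
    thus ?thesis
      by (simp add: X.spectral_power_norm_sq_eq[OF orth] s_powr)
  qed
  have "(\<exists>C>0. \<exists>\<alpha>\<^sub>0>0. \<forall>\<alpha>. 0 < \<alpha> \<and> \<alpha> \<le> \<alpha>\<^sub>0 \<longrightarrow>
            spectral_power_norm_sq smulX ipX \<sigma> v \<nu> (tikhonov ipX ipY A y \<alpha> - x)
              \<le> ennreal (C * \<alpha> powr (2 * (\<nu> + \<mu>))))
      \<longleftrightarrow> (\<exists>C>0. \<exists>\<alpha>\<^sub>0>0. \<forall>\<alpha>. 0 < \<alpha> \<and> \<alpha> \<le> \<alpha>\<^sub>0 \<longrightarrow>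
            (\<Sum>n. ennreal (s n powr (2 * \<nu>) * ((\<alpha> / (s n + \<alpha>))\<^sup>2 * c n)))
              \<le> ennreal (C * \<alpha> powr (2 * (\<nu> + \<mu>))))"
    by (simp add: error cong: conj_cong)
  also have "\<dots> \<longleftrightarrow> (\<lambda>k. \<Sum>n. c (k + n)) \<in> O(\<lambda>k. s k powr (2 * \<mu>))"
    using filtered_sum_bound_iff_mass_below[OF s(2) c assms(10-12)]
      tails_bigo_iff_mass_below[OF s c, of "2 * \<mu>"] \<open>0 < \<mu>\<close>
    by simp
  also have "\<dots> \<longleftrightarrow> (\<lambda>k. \<Sum>n. (norm (ipX x (v (k + n))))\<^sup>2) \<in> O(\<lambda>k. \<sigma> k powr (4 * \<mu>))"
    by (simp add: c_def s_powr)
  finally show ?thesis .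
qed

end
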